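(* Let $Q\in\mathbb{R}^{n\times n}$ be a symmetric matrix, $A\in\mathbb{R}^{m\times n}$, $q\in\mathbb{R}^n$, $b\in\mathbb{R}^m$, let $f(x)=\frac12 x^\top Qx+q^\top x$, and assume that $C=\{x\in\mathbb{R}^n\mid Ax\ge b\}$ is nonempty. Let $\eta,\rho>0$, assume that $f$ is bounded below on $C$, let $x^0\in C$, and let $x(\cdot)$ be the unique solution on $[0,+\infty)$ of $$\dot x(t)=\frac1\eta\Big[P_C\Big(x(t)-\frac1\rho\big(Qx(t)+q\big)\Big)-x(t)\Big]\quad (t\ge 0),\qquad x(0)=x^0.$$ Then $$f\big(x(t_2)\big)\le f\big(x(t_1)\big)-\rho\eta\int_{t_1}^{t_2}\|\dot x(s)\|^2\,ds$$ for all $t_1,t_2\ge 0$ with $t_1\le t_2$.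
   Context: $\mathbb{R}^n$ carries the Euclidean scalar product and norm. Inequalities between vectors are componentwise. $P_C$ is the metric projection onto the closed convex set $C$, i.e. $P_C(x)$ is the unique $y\in C$ with $\|y-x\|=\inf_{z\in C}\|z-x\|$. It is known that for every $x^0\in\mathbb{R}^n$, $\rho>0$, $\eta>0$ the initial value problem $\dot x(t)=\frac1\eta\big[P_C\big(x(t)-\frac1\rho(Qx(t)+q)\big)-x(t)\big]$ $(t\ge 0)$, $x(0)=x^0$, has a unique $C^1$ solution $x:[0,+\infty)\to\mathbb{R}^n$. *)

theory Defs
  imports "HOL-Analysis.Analysis"
begin

definition quad_fun :: "real^'n^'n \<Rightarrow> real^'n \<Rightarrow> real^'n \<Rightarrow> real" where
  "quad_fun Q q x = 1/2 * (x \<bullet> (Q *v x)) + q \<bullet> x"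

(* The order on vectors is the componentwise one. *)
definition feasible_set :: "real^'n^'m \<Rightarrow> real^'m \<Rightarrow> (real^'n) set" where
  "feasible_set A b = {x. A *v x \<ge> b}"

(* The derivative is taken within [0, \<infinity>), hence one-sided at 0, and the values
   of x at negative times are irrelevant.  The constant closest_point C is the metric
   projection onto C whenever C is closed, convex and nonempty. *)
definition solves_projected_ivp ::
  "(real^'n) set \<Rightarrow> real^'n^'n \<Rightarrow> real^'n \<Rightarrow> real \<Rightarrow> real \<Rightarrow> real^'n \<Rightarrow> (real \<Rightarrow> real^'n) \<Rightarrow> bool" where
  "solves_projected_ivp C Q q \<eta> \<rho> x0 x \<longleftrightarrow>
     x 0 = x0 \<and>
     (\<forall>t\<ge>0. (x has_vector_derivative
        (1/\<eta>) *\<^sub>R (closest_point C (x t - (1/\<rho>) *\<^sub>R (Q *v x t + q)) - x t))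
        (at t within {0..}))"

end

theory Submission
  imports Defs
begin

text \<open>
  Along a solution the derivative of the objective is the inner product of the gradient
  \<open>g = Q x + q\<close> with the velocity \<open>v\<close>, and \<open>\<eta> v\<close> is the step from \<open>x\<close> to the projection \<open>p\<close>
  of \<open>x - g/\<rho>\<close> onto \<open>C = {x. A x \<ge> b}\<close>.  If \<open>x\<close> itself lies in \<open>C\<close>, it may be used as the test
  point in the variational inequality that characterises \<open>p\<close>, which gives
  \<open>g \<bullet> v \<le> - \<rho> \<eta> \<parallel>v\<parallel>\<^sup>2\<close> (lemma \<open>projected_step_descent\<close>); integrating from \<open>t1\<close> to \<open>t2\<close>
  is the claim.

  It remains to see that the trajectory does not leave \<open>C\<close>.  The velocity always points from \<open>x\<close>
  towards some point of \<open>C\<close>, so no closed half-space containing \<open>C\<close> can be left (lemma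
  \<open>flow_towards_halfspace\<close>), and a closed convex set is the intersection of the closed half-spaces
  containing it (lemma \<open>flow_towards_convex\<close>).
\<close>

text \<open>
  Variation of constants: \<open>exp (t/\<eta>) * (a \<bullet> x t - c)\<close> has the derivative
  \<open>exp (t/\<eta>) * (a \<bullet> u t - c) / \<eta> \<le> 0\<close>, so it stays below its initial value, which is
  nonpositive.
\<close>

lemma flow_towards_halfspace:
  fixes x u :: "real \<Rightarrow> 'a::real_inner"
  assumes deriv: "\<And>t. t \<ge> 0 \<Longrightarrow>
      (x has_vector_derivative (1/\<eta>) *\<^sub>R (u t - x t)) (at t within {0..})"
    and "\<eta> > 0"
    and target: "\<And>t. t \<ge> 0 \<Longrightarrow> a \<bullet> u t \<le> c"
    and init: "a \<bullet> x 0 \<le> c"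
    and "t \<ge> 0"
  shows "a \<bullet> x t \<le> c"
proof -
  define \<phi> where "\<phi> s = exp (s/\<eta>) * (a \<bullet> x s - c)" for s
  have \<phi>: "(\<phi> has_real_derivative exp (s/\<eta>) * (a \<bullet> u s - c) / \<eta>) (at s within {0..})"
    if "s \<ge> 0" for s
  proof -
    have "((\<lambda>s. a \<bullet> x s) has_vector_derivative a \<bullet> ((1/\<eta>) *\<^sub>R (u s - x s))) (at s within {0..})"
      by (intro bounded_linear.has_vector_derivative[OF bounded_linear_inner_right] deriv that)
    then have *: "((\<lambda>s. a \<bullet> x s) has_real_derivative (a \<bullet> u s - a \<bullet> x s) / \<eta>) (at s within {0..})"
      by (simp add: has_real_derivative_iff_has_vector_derivative inner_diff_right)
    show ?thesis
      unfolding \<phi>_def using \<open>\<eta> > 0\<close>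
      by (auto intro!: derivative_eq_intros * simp: field_simps)
  qed
  have "\<phi> t \<le> \<phi> 0"
  proof (rule DERIV_nonpos_imp_decreasing_open[OF \<open>t \<ge> 0\<close>])
    fix s assume "0 < s" "s < t"
    then have "(\<phi> has_real_derivative exp (s/\<eta>) * (a \<bullet> u s - c) / \<eta>) (at s)"
      using \<phi>[of s] at_within_interior[of s "{0..}"] by (simp add: interior_Ici)
    moreover have "exp (s/\<eta>) * (a \<bullet> u s - c) / \<eta> \<le> 0"
      using target[of s] \<open>0 < s\<close> \<open>\<eta> > 0\<close>
      by (simp add: divide_nonpos_pos mult_nonneg_nonpos)
    ultimately show "\<exists>y. (\<phi> has_real_derivative y) (at s) \<and> y \<le> 0"
      by blast
  next
    have "continuous_on {0..} \<phi>"
      using \<phi> by (intro DERIV_continuous_on) auto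
    then show "continuous_on {0..t} \<phi>"
      by (rule continuous_on_subset) auto
  qed
  also have "\<phi> 0 \<le> 0"
    using init by (simp add: \<phi>_def)
  finally show ?thesis
    by (simp add: \<phi>_def mult_le_0_iff)
qed

text \<open>
  If \<open>x t\<close> were outside \<open>C\<close>, the half-space supporting \<open>C\<close> at the point closest to \<open>x t\<close> would
  contain \<open>C\<close> but not \<open>x t\<close>.
\<close>

lemma flow_towards_convex:
  fixes x u :: "real \<Rightarrow> 'a::euclidean_space"
  assumes "convex C" "closed C"
    and deriv: "\<And>t. t \<ge> 0 \<Longrightarrow>
      (x has_vector_derivative (1/\<eta>) *\<^sub>R (u t - x t)) (at t within {0..})"
    and "\<eta> > 0"
    and target: "\<And>t. t \<ge> 0 \<Longrightarrow> u t \<in> C"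
    and init: "x 0 \<in> C"
    and "t \<ge> 0"
  shows "x t \<in> C"
proof -
  define p where "p = closest_point C (x t)"
  have sup: "(x t - p) \<bullet> y \<le> (x t - p) \<bullet> p" if "y \<in> C" for y
    using closest_point_dot[OF assms(1,2) that, of "x t"] by (simp add: p_def inner_diff_right)
  have "(x t - p) \<bullet> x t \<le> (x t - p) \<bullet> p"
    using flow_towards_halfspace[OF deriv \<open>\<eta> > 0\<close>] sup target init \<open>t \<ge> 0\<close> by blast
  then have "(x t - p) \<bullet> (x t - p) \<le> 0"
    by (simp add: inner_diff_right)
  then have "x t = p"
    by (metis inner_gt_zero_iff eq_iff_diff_eq_0 not_less)
  moreover have "p \<in> C"
    unfolding p_def using init by (intro closest_point_in_set[OF \<open>closed C\<close>]) auto
  ultimately show ?thesis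
    by simp
qed

text \<open>
  The variational inequality of the projection, tested at \<open>x\<close>, says that the direction from the
  projection back to \<open>x\<close> makes no acute angle with the residual \<open>x - g/\<rho> - p\<close>.
\<close>

lemma projected_step_descent:
  fixes x g :: "'a::euclidean_space"
  assumes "convex C" "closed C" "x \<in> C" "\<rho> > 0"
  defines "d \<equiv> closest_point C (x - (1/\<rho>) *\<^sub>R g) - x"
  shows "g \<bullet> d \<le> - \<rho> * (norm d)\<^sup>2"
proof -
  have "(x - (1/\<rho>) *\<^sub>R g - (x + d)) \<bullet> (x - (x + d)) \<le> 0"
    using closest_point_dot[OF assms(1-3), of "x - (1/\<rho>) *\<^sub>R g"] by (simp add: d_def)
  then have "d \<bullet> d + (g \<bullet> d) / \<rho> \<le> 0"
    by (simp add: inner_diff_left algebra_simps)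
  then show ?thesis
    using \<open>\<rho> > 0\<close> by (simp add: power2_norm_eq_inner field_simps)
qed

lemma feasible_set_halfspaces: "feasible_set A b = (\<Inter>i. {x. row i A \<bullet> x \<ge> b $ i})"
  by (auto simp: feasible_set_def less_eq_vec_def matrix_vector_mul_component row_def)

lemma convex_feasible_set: "convex (feasible_set A b)"
  unfolding feasible_set_halfspaces by (intro convex_INT convex_halfspace_ge)

lemma closed_feasible_set: "closed (feasible_set A b)"
  unfolding feasible_set_halfspaces by (intro closed_INT ballI closed_halfspace_ge)

text \<open>
  Symmetry of \<open>Q\<close> makes the two terms of the product rule equal, so that the gradient is
  \<open>Q x + q\<close> rather than \<open>1/2 (Q + Q\<^sup>T) x + q\<close>.
\<close>

lemma has_vector_derivative_quad_fun:
  fixes x :: "real \<Rightarrow> real^'n"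
  assumes "transpose Q = Q" and x: "(x has_vector_derivative v) (at t within S)"
  shows "((\<lambda>s. quad_fun Q q (x s)) has_vector_derivative (Q *v x t + q) \<bullet> v) (at t within S)"
proof -
  have Qx: "((\<lambda>s. Q *v x s) has_vector_derivative Q *v v) (at t within S)"
    by (intro bounded_linear.has_vector_derivative[OF matrix_vector_mul_bounded_linear] x)
  have lin: "((\<lambda>s. q \<bullet> x s) has_vector_derivative q \<bullet> v) (at t within S)"
    by (intro bounded_linear.has_vector_derivative[OF bounded_linear_inner_right] x)
  have quad: "((\<lambda>s. x s \<bullet> (Q *v x s)) has_vector_derivative
      x t \<bullet> (Q *v v) + v \<bullet> (Q *v x t)) (at t within S)"
    by (intro bounded_bilinear.has_vector_derivative[OF bounded_bilinear_inner] x Qx)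
  have sym: "x t \<bullet> (Q *v v) = v \<bullet> (Q *v x t)"
    by (metis assms(1) dot_lmul_matrix inner_commute vector_transpose_matrix)
  have "((\<lambda>s. 1/2 * (x s \<bullet> (Q *v x s)) + q \<bullet> x s) has_vector_derivative
      1/2 * (x t \<bullet> (Q *v v) + v \<bullet> (Q *v x t)) + q \<bullet> v) (at t within S)"
    by (intro has_vector_derivative_add lin
        bounded_linear.has_vector_derivative[OF bounded_linear_mult_right] quad)
  then show ?thesis
    by (simp add: quad_fun_def sym inner_commute inner_add_left inner_add_right)
qed

theorem theorem11:
  fixes Q :: "real^'n^'n" and A :: "real^'n^'m" and q :: "real^'n" and b :: "real^'m"
    and \<eta> \<rho> :: real and x0 :: "real^'n" and x :: "real \<Rightarrow> real^'n" and t1 t2 :: real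
  assumes "transpose Q = Q"
    and "feasible_set A b \<noteq> {}"
    and "\<eta> > 0" and "\<rho> > 0"
    and "bdd_below (quad_fun Q q ` feasible_set A b)"
    and "x0 \<in> feasible_set A b"
    and "solves_projected_ivp (feasible_set A b) Q q \<eta> \<rho> x0 x"
    and "0 \<le> t1" and "0 \<le> t2" and "t1 \<le> t2"
  shows "quad_fun Q q (x t2) \<le> quad_fun Q q (x t1)
           - \<rho> * \<eta> * integral {t1..t2} (\<lambda>s. (norm (vector_derivative x (at s within {0..})))\<^sup>2)"
proof -
  define C where "C = feasible_set A b"
  note C = convex_feasible_set[of A b, folded C_def] closed_feasible_set[of A b, folded C_def]
    assms(2)[folded C_def]
  define g where "g s = Q *v x s + q" for s
  define p where "p s = closest_point C (x s - (1/\<rho>) *\<^sub>R g s)" for s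
  define v where "v s = (1/\<eta>) *\<^sub>R (p s - x s)" for s
  have x0: "x 0 \<in> C" and deriv: "\<And>t. t \<ge> 0 \<Longrightarrow> (x has_vector_derivative v t) (at t within {0..})"
    using assms(6,7) by (auto simp: solves_projected_ivp_def C_def g_def p_def v_def)
  \<comment> \<open>Feasibility is what makes \<open>x t\<close> an admissible test point for the projection.\<close>
  have viable: "x t \<in> C" if "t \<ge> 0" for t
    using flow_towards_convex[OF C(1,2) deriv[unfolded v_def] \<open>\<eta> > 0\<close> _ x0 that]
      closest_point_in_set[OF C(2,3)] by (simp add: p_def)
  have descent: "g t \<bullet> v t \<le> - (\<rho> * \<eta>) * (norm (v t))\<^sup>2" if "t \<ge> 0" for t
  proof -
    have "p t - x t = \<eta> *\<^sub>R v t"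
      using \<open>\<eta> > 0\<close> by (simp add: v_def)
    then have "\<eta> * (g t \<bullet> v t) \<le> \<eta> * (- (\<rho> * \<eta>) * (norm (v t))\<^sup>2)"
      using projected_step_descent[OF C(1,2) viable[OF that] \<open>\<rho> > 0\<close>, of "g t"] \<open>\<eta> > 0\<close>
      by (simp add: p_def[symmetric] power2_eq_square algebra_simps)
    then show ?thesis
      using \<open>\<eta> > 0\<close> by (simp only: mult_le_cancel_left_pos)
  qed
  have sub: "{t1..t2} \<subseteq> {0..}"
    using \<open>0 \<le> t1\<close> by auto
  have "continuous_on {0..} x"
    by (auto simp: continuous_on_eq_continuous_within
        intro: has_vector_derivative_continuous[OF deriv])
  then have "continuous_on {t1..t2} x"
    by (rule continuous_on_subset[OF _ sub])
  then have "continuous_on {t1..t2} v"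
    unfolding v_def p_def g_def
    by (intro continuous_intros continuous_on_compose2[OF continuous_on_closest_point[OF C, of UNIV]]
        continuous_on_compose2[OF matrix_vector_mult_linear_continuous_on[of UNIV]]) auto
  then have bound: "((\<lambda>s. - (\<rho> * \<eta>) * (norm (v s))\<^sup>2) has_integral
      - (\<rho> * \<eta>) * integral {t1..t2} (\<lambda>s. (norm (v s))\<^sup>2)) {t1..t2}"
    by (intro has_integral_mult_right integrable_integral integrable_continuous_real continuous_intros)
  have "((\<lambda>s. g s \<bullet> v s) has_integral quad_fun Q q (x t2) - quad_fun Q q (x t1)) {t1..t2}"
    unfolding g_def using assms(1,10) sub
    by (intro fundamental_theorem_of_calculus has_vector_derivative_quad_fun
        has_vector_derivative_within_subset[OF deriv _ ]) auto
  then have "quad_fun Q q (x t2) - quad_fun Q q (x t1)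
      \<le> - (\<rho> * \<eta>) * integral {t1..t2} (\<lambda>s. (norm (v s))\<^sup>2)"
    by (rule has_integral_le[OF _ bound]) (use descent sub in auto)
  moreover have "integral {t1..t2} (\<lambda>s. (norm (vector_derivative x (at s within {0..})))\<^sup>2)
      = integral {t1..t2} (\<lambda>s. (norm (v s))\<^sup>2)"
  proof (rule integral_cong)
    fix s assume "s \<in> {t1..t2}"
    then have "s \<ge> 0"
      using sub by auto
    \<comment> \<open>One-sided derivatives on the half-line are unique because no point of it is isolated.\<close>
    then have "at_right s \<le> at s within {0..}"
      by (intro at_le) auto
    then have "at s within {0..} \<noteq> bot"
      using trivial_limit_at_right_real[of s] by (auto simp: bot_unique)
    then show "(norm (vector_derivative x (at s within {0..})))\<^sup>2 = (norm (v s))\<^sup>2"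
      by (simp add: vector_derivative_within[OF _ deriv[OF \<open>s \<ge> 0\<close>]])
  qed
  ultimately show ?thesis
    by simp
qed

end
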